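(* Let $x=\sum_{i=0}^\infty2^{e_i}\in\mathbb{Z}_2$ with integers $0\le e_0<e_1<\cdots$, and suppose there is a positive integer $N$ such that $e_k>k+\sum_{i=0}^{k-1}2^{e_i}$ for all $k\ge N$. Then $\bar f(x)$ is $2$-definable, where $f(n)=\sum_{j=0}^n\binom nj^{-1}$.
   Context: For $x=\sum_{i\ge0}\varepsilon_i2^i\in\mathbb{Z}_2$ with $\varepsilon_i\in\{0,1\}$, let $x_n=\sum_{i=0}^n\varepsilon_i2^i$. One says $\bar f(x)$ is $2$-definable if $\lim_{n\to\infty}f(x_n)$ exists in $\mathbb{Q}_2$ (2-adic topology), and then $\bar f(x)$ is this limit. *)

theory Defs
  imports Complex_Main "HOL-Computational_Algebra.Primes"
begin

text \<open>The field of 2-adic numbers is built as the completion of the rationals with respect to the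
  2-adic absolute value.  The instances \<^class>\<open>field_char_0\<close> and \<^class>\<open>complete_space\<close> together with
  \<open>norm2_of_rat\<close> and \<open>of_rat_dense_padic2\<close> below show that it is this completion.\<close>

definition val2 :: "rat \<Rightarrow> int" where
  "val2 q = (let (a, b) = quotient_of q in int (multiplicity 2 a) - int (multiplicity 2 b))"

definition abs2 :: "rat \<Rightarrow> real" where
  "abs2 q = (if q = 0 then 0 else 2 powi (- val2 q))"

lemma val2_divide:
  assumes "a \<noteq> 0" "b \<noteq> 0"
  shows "val2 (of_int a / of_int b) = int (multiplicity 2 a) - int (multiplicity 2 b)"
proof -
  obtain c d where cd: "quotient_of (of_int a / of_int b) = (c, d)" by fastforce
  have d: "d > 0" using quotient_of_denom_pos[OF cd] .
  have eq: "(of_int a / of_int b :: rat) = of_int c / of_int d" using quotient_of_div[OF cd] .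
  then have "(of_int (a * d) :: rat) = of_int (c * b)"
    using assms d by (simp add: field_simps)
  then have ad: "a * d = c * b" by (simp only: of_int_eq_iff)
  then have c: "c \<noteq> 0" using assms d by auto
  have p: "prime_elem (2 :: int)" by simp
  have "multiplicity 2 a + multiplicity 2 d = multiplicity 2 c + multiplicity 2 b"
    using prime_elem_multiplicity_mult_distrib[OF p, of a d]
      prime_elem_multiplicity_mult_distrib[OF p, of c b] ad assms c d by simp
  then show ?thesis unfolding val2_def cd by simp
qed

lemma rat_cases2:
  fixes x :: rat
  obtains a b :: int where "b \<noteq> 0" "x = of_int a / of_int b" 
  by (metis quotient_of_denom_pos quotient_of_div less_irrefl surj_pair)

lemma abs2_zero [simp]: "abs2 0 = 0" by (simp add: abs2_def)
lemma abs2_eq_0_iff [simp]: "abs2 x = 0 \<longleftrightarrow> x = 0" by (simp add: abs2_def)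
lemma abs2_nonneg [simp]: "abs2 x \<ge> 0" by (simp add: abs2_def)

lemma abs2_mult: "abs2 (x * y) = abs2 x * abs2 y"
proof (cases "x = 0 \<or> y = 0")
  case False
  obtain a b where x: "b \<noteq> 0" "x = of_int a / of_int b" by (rule rat_cases2)
  obtain c d where y: "d \<noteq> 0" "y = of_int c / of_int d" by (rule rat_cases2)
  have nz: "a \<noteq> 0" "c \<noteq> 0" using False x y by auto
  have xy: "x * y = of_int (a * c) / of_int (b * d)" using x y by simp
  have p: "prime_elem (2 :: int)" by simp
  have "val2 (x * y) = val2 x + val2 y"
    unfolding xy unfolding x(2) y(2) using nz x y
    by (simp add: val2_divide prime_elem_multiplicity_mult_distrib[OF p] del: of_int_mult)
  then show ?thesis using False by (simp add: abs2_def power_int_add[symmetric])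
qed auto

lemma abs2_one [simp]: "abs2 1 = 1"
  using val2_divide[of 1 1] by (simp add: abs2_def)

lemma abs2_minus [simp]: "abs2 (- x) = abs2 x"
proof -
  have "abs2 (-1) * abs2 (-1) = 1" using abs2_mult[of "-1" "-1"] by simp
  then have "abs2 (-1) = 1" using abs2_nonneg[of "-1"]
    by (metis abs_of_nonneg real_sqrt_abs2 real_sqrt_one)
  then show ?thesis using abs2_mult[of "-1" x] by simp
qed

lemma abs2_minus_commute: "abs2 (x - y) = abs2 (y - x)"
  using abs2_minus[of "x - y"] by simp

lemma abs2_inverse: "abs2 (inverse x) = inverse (abs2 x)"
proof (cases "x = 0")
  case False
  then have "abs2 x * abs2 (inverse x) = 1" using abs2_mult[of x "inverse x"] by simp
  then show ?thesis by (metis inverse_unique)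
qed simp

lemma abs2_add_le: "abs2 (x + y) \<le> max (abs2 x) (abs2 y)"
proof (cases "x = 0 \<or> y = 0 \<or> x + y = 0")
  case False
  obtain a b where x: "b \<noteq> 0" "x = of_int a / of_int b" by (rule rat_cases2)
  obtain c d where y: "d \<noteq> 0" "y = of_int c / of_int d" by (rule rat_cases2)
  define m n k where "m = a * d" and "n = c * b" and "k = b * d"
  have k: "k \<noteq> 0" using x y by (simp add: k_def)
  have xm: "x = of_int m / of_int k" and yn: "y = of_int n / of_int k"
    using x y by (simp_all add: m_def n_def k_def)
  have s: "x + y = of_int (m + n) / of_int k" unfolding xm yn by (simp add: add_divide_distrib)
  have nz: "m \<noteq> 0" "n \<noteq> 0" "m + n \<noteq> 0" using False s xm yn by auto
  define r where "r = min (multiplicity 2 m) (multiplicity 2 n)"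
  have "2 ^ r dvd m + n"
    by (intro dvd_add multiplicity_dvd') (auto simp: r_def)
  then have "r \<le> multiplicity 2 (m + n)"
    using nz by (intro multiplicity_geI) auto
  then have "min (val2 x) (val2 y) \<le> val2 (x + y)"
    unfolding s unfolding xm yn using nz k by (simp add: val2_divide r_def del: of_int_add)
  then have "- val2 (x + y) \<le> max (- val2 x) (- val2 y)" by linarith
  then have "(2::real) powi (- val2 (x + y)) \<le> 2 powi (max (- val2 x) (- val2 y))"
    by (intro power_int_increasing) auto
  then show ?thesis using False by (auto simp: abs2_def max_def split: if_splits)
qed (auto simp: max_def add_eq_0_iff)

lemma abs2_triangle: "abs2 (x + y) \<le> abs2 x + abs2 y"
  using abs2_add_le[of x y] abs2_nonneg[of x] abs2_nonneg[of y] by linarith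

lemma abs2_diff_bound: "\<bar>abs2 x - abs2 y\<bar> \<le> abs2 (x - y)"
  using abs2_triangle[of "x - y" y] abs2_triangle[of "y - x" x] abs2_minus_commute[of x y] by simp

lemma abs2_isosceles:
  assumes "abs2 (x - y) < abs2 y" shows "abs2 x = abs2 y"
  using abs2_add_le[of "x - y" y] abs2_add_le[of "y - x" x] abs2_minus_commute[of x y] assms
  by (auto simp: max_def split: if_splits)

definition cauchy2 :: "(nat \<Rightarrow> rat) \<Rightarrow> bool" where
  "cauchy2 X \<longleftrightarrow> (\<forall>e>0. \<exists>M. \<forall>m\<ge>M. \<forall>n\<ge>M. abs2 (X m - X n) < e)"

definition null2 :: "(nat \<Rightarrow> rat) \<Rightarrow> bool" where
  "null2 X \<longleftrightarrow> (\<lambda>n. abs2 (X n)) \<longlonglongrightarrow> 0"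

lemma cauchy2_const [simp]: "cauchy2 (\<lambda>_. c)" by (auto simp: cauchy2_def)

lemma null2_const [simp]: "null2 (\<lambda>_. c) \<longleftrightarrow> c = 0"
  by (simp add: null2_def LIMSEQ_const_iff)

lemma cauchy2_lin:
  assumes "cauchy2 X" "cauchy2 Y" "\<And>m n. abs2 (Z m - Z n) \<le> max (abs2 (X m - X n)) (abs2 (Y m - Y n))"
  shows "cauchy2 Z"
  unfolding cauchy2_def
proof (intro allI impI)
  fix e :: real assume "e > 0"
  then obtain M N where M: "\<forall>m\<ge>M. \<forall>n\<ge>M. abs2 (X m - X n) < e"
    and N: "\<forall>m\<ge>N. \<forall>n\<ge>N. abs2 (Y m - Y n) < e"
    using assms unfolding cauchy2_def by metis
  have "abs2 (Z m - Z n) < e" if "m \<ge> max M N" "n \<ge> max M N" for m n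
    using M N that assms(3)[of m n] 
    by (smt (verit, best) max.bounded_iff)
  then show "\<exists>M. \<forall>m\<ge>M. \<forall>n\<ge>M. abs2 (Z m - Z n) < e" by blast
qed

lemma cauchy2_minus: "cauchy2 X \<Longrightarrow> cauchy2 (\<lambda>n. - X n)"
  by (rule cauchy2_lin) (auto simp: abs2_minus_commute)

lemma cauchy2_add: "cauchy2 X \<Longrightarrow> cauchy2 Y \<Longrightarrow> cauchy2 (\<lambda>n. X n + Y n)"
proof (erule (1) cauchy2_lin)
  fix m n
  show "abs2 (X m + Y m - (X n + Y n)) \<le> max (abs2 (X m - X n)) (abs2 (Y m - Y n))"
    using abs2_add_le[of "X m - X n" "Y m - Y n"] by (simp add: algebra_simps)
qed

lemma cauchy2_diff: "cauchy2 X \<Longrightarrow> cauchy2 Y \<Longrightarrow> cauchy2 (\<lambda>n. X n - Y n)"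
  using cauchy2_add[OF _ cauchy2_minus] by simp

lemma cauchy2_bounded:
  assumes "cauchy2 X" obtains B where "B > 0" "\<And>n. abs2 (X n) \<le> B"
proof -
  obtain M where M: "\<forall>m\<ge>M. \<forall>n\<ge>M. abs2 (X m - X n) < 1"
    using assms unfolding cauchy2_def by (meson zero_less_one)
  define B where "B = Max ((\<lambda>n. abs2 (X n)) ` {..M}) + 1"
  have *: "abs2 (X n) \<le> B - 1" if "n \<le> M" for n
    unfolding B_def using that by simp
  have "abs2 (X n) \<le> B" for n
  proof (cases "n \<le> M")
    case False
    then have "abs2 (X n - X M) < 1" using M by auto
    then show ?thesis using *[of M] abs2_diff_bound[of "X n" "X M"] by auto
  qed (use *[of n] in auto)
  moreover have "B > 0" using *[of 0] abs2_nonneg[of "X 0"] by linarith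
  ultimately show ?thesis using that by blast
qed

lemma cauchy2_mult:
  assumes "cauchy2 X" "cauchy2 Y" shows "cauchy2 (\<lambda>n. X n * Y n)"
  unfolding cauchy2_def
proof (intro allI impI)
  fix e :: real assume e: "e > 0"
  obtain A where A: "A > 0" "\<And>n. abs2 (X n) \<le> A" using cauchy2_bounded[OF assms(1)] by blast
  obtain B where B: "B > 0" "\<And>n. abs2 (Y n) \<le> B" using cauchy2_bounded[OF assms(2)] by blast
  obtain M where M: "\<forall>m\<ge>M. \<forall>n\<ge>M. abs2 (X m - X n) < e / B"
    using assms(1) e B unfolding cauchy2_def by (meson divide_pos_pos)
  obtain N where N: "\<forall>m\<ge>N. \<forall>n\<ge>N. abs2 (Y m - Y n) < e / A"
    using assms(2) e A unfolding cauchy2_def by (meson divide_pos_pos)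
  have "abs2 (X m * Y m - X n * Y n) < e" if "m \<ge> max M N" "n \<ge> max M N" for m n
  proof -
    have eq: "X m * Y m - X n * Y n = (X m - X n) * Y m + X n * (Y m - Y n)"
      by (simp add: algebra_simps)
    have "abs2 ((X m - X n) * Y m) \<le> abs2 (X m - X n) * B"
      using B by (simp add: abs2_mult mult_left_mono)
    also have "\<dots> < e" using M that B by (simp add: pos_less_divide_eq)
    finally have 1: "abs2 ((X m - X n) * Y m) < e" .
    have "abs2 (X n * (Y m - Y n)) \<le> A * abs2 (Y m - Y n)"
      using A by (simp add: abs2_mult mult_right_mono)
    also have "\<dots> < e" using N that A by (simp add: pos_less_divide_eq mult.commute)
    finally show ?thesis unfolding eq using 1 abs2_add_le
      by (metis (no_types, lifting) max_less_iff_conj order_le_less_trans)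
  qed
  then show "\<exists>M. \<forall>m\<ge>M. \<forall>n\<ge>M. abs2 (X m * Y m - X n * Y n) < e" by blast
qed

lemma null2_le:
  assumes "null2 X" "\<And>n. abs2 (Z n) \<le> B * abs2 (X n)" shows "null2 Z"
  unfolding null2_def
proof (rule tendsto_sandwich[OF _ _ tendsto_const])
  show "(\<lambda>n. B * abs2 (X n)) \<longlonglongrightarrow> 0"
    using tendsto_mult_right_zero[of _ _ B] assms(1) unfolding null2_def by blast
qed (use assms in auto)

lemma null2_add: assumes "null2 X" "null2 Y" shows "null2 (\<lambda>n. X n + Y n)"
  unfolding null2_def
proof (rule tendsto_sandwich[OF _ _ tendsto_const])
  show "(\<lambda>n. abs2 (X n) + abs2 (Y n)) \<longlonglongrightarrow> 0"
    using tendsto_add[of _ 0 _ _ 0] assms unfolding null2_def by fastforce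
qed (auto simp: abs2_triangle)

lemma null2_minus: "null2 (\<lambda>n. - X n) \<longleftrightarrow> null2 X" by (simp add: null2_def)

lemma null2_diff: assumes "null2 X" "null2 Y" shows "null2 (\<lambda>n. X n - Y n)"
  using null2_add[of X "\<lambda>n. - Y n"] assms by (simp add: null2_minus)

lemma null2_mult: assumes "null2 X" "cauchy2 Y" shows "null2 (\<lambda>n. X n * Y n)"
proof -
  obtain B where B: "B > 0" "\<And>n. abs2 (Y n) \<le> B" using cauchy2_bounded[OF assms(2)] by blast
  show ?thesis by (rule null2_le[OF assms(1), of _ B]) (simp add: abs2_mult B mult_right_mono mult.commute[of "abs2 (X _)"])
qed

lemma abs2_eventually_const:
  assumes "cauchy2 X" "\<not> null2 X"
  obtains c N where "c > 0" "\<And>n. n \<ge> N \<Longrightarrow> abs2 (X n) = c"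
proof -
  obtain e where e: "e > 0" "\<And>N. \<exists>n\<ge>N. abs2 (X n) \<ge> e"
    using assms(2) unfolding null2_def LIMSEQ_iff by (auto simp: not_less)
  obtain M where M: "\<forall>m\<ge>M. \<forall>n\<ge>M. abs2 (X m - X n) < e"
    using assms(1) e unfolding cauchy2_def by blast
  obtain k where k: "k \<ge> M" "abs2 (X k) \<ge> e" using e by blast
  have "abs2 (X n) = abs2 (X k)" if "n \<ge> M" for n
    using M k that abs2_isosceles[of "X n" "X k"] by fastforce
  then show ?thesis using that[of "abs2 (X k)" M] e k by fastforce
qed

lemma cauchy2_inverse:
  assumes "cauchy2 X" "\<not> null2 X" shows "cauchy2 (\<lambda>n. inverse (X n))"
  unfolding cauchy2_def
proof (intro allI impI)
  fix e :: real assume e: "e > 0"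
  obtain c N where c: "c > 0" "\<And>n. n \<ge> N \<Longrightarrow> abs2 (X n) = c"
    using abs2_eventually_const[OF assms] by blast
  obtain M where M: "\<forall>m\<ge>M. \<forall>n\<ge>M. abs2 (X m - X n) < e * c * c"
    using assms(1) e c unfolding cauchy2_def by (meson mult_pos_pos)
  have "abs2 (inverse (X m) - inverse (X n)) < e" if "m \<ge> max M N" "n \<ge> max M N" for m n
  proof -
    have nz: "X m \<noteq> 0" "X n \<noteq> 0" using c(2)[of m] c(2)[of n] c(1) that by auto
    have "inverse (X m) - inverse (X n) = (X n - X m) * inverse (X m) * inverse (X n)"
      using nz by (simp add: field_simps)
    then have "abs2 (inverse (X m) - inverse (X n)) = abs2 (X n - X m) / (c * c)"
      using c(2)[of m] c(2)[of n] that by (simp add: abs2_mult abs2_inverse divide_inverse)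
    also have "\<dots> < e" using M that c by (simp add: pos_divide_less_eq mult.assoc)
    finally show ?thesis .
  qed
  then show "\<exists>M. \<forall>m\<ge>M. \<forall>n\<ge>M. abs2 (inverse (X m) - inverse (X n)) < e" by blast
qed

text \<open>Partial equivalence relation: Cauchy sequences modulo null sequences.\<close>

definition rel2 :: "(nat \<Rightarrow> rat) \<Rightarrow> (nat \<Rightarrow> rat) \<Rightarrow> bool" where
  "rel2 X Y \<longleftrightarrow> cauchy2 X \<and> cauchy2 Y \<and> null2 (\<lambda>n. X n - Y n)"

lemma null2_rel: "rel2 X Y \<Longrightarrow> null2 X \<longleftrightarrow> null2 Y"
  using null2_add[of "\<lambda>n. X n - Y n" Y] null2_diff[of X "\<lambda>n. X n - Y n"]
  by (auto simp: rel2_def)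

lemma part_equivp_rel2: "part_equivp rel2"
proof (rule part_equivpI)
  show "\<exists>X. rel2 X X" by (rule exI[of _ "\<lambda>_. 0"]) (simp add: rel2_def)
  show "symp rel2"
  proof (rule sympI)
    fix X Y assume "rel2 X Y"
    then show "rel2 Y X" using null2_minus[of "\<lambda>n. X n - Y n"] by (simp add: rel2_def)
  qed
  show "transp rel2"
  proof (rule transpI)
    fix X Y Z assume "rel2 X Y" "rel2 Y Z"
    then show "rel2 X Z" using null2_add[of "\<lambda>n. X n - Y n" "\<lambda>n. Y n - Z n"] by (simp add: rel2_def)
  qed
qed

quotient_type padic2 = "nat \<Rightarrow> rat" / partial: rel2
  by (rule part_equivp_rel2)

instantiation padic2 :: field
begin

lift_definition zero_padic2 :: padic2 is "\<lambda>_. 0" by (simp add: rel2_def)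
lift_definition one_padic2 :: padic2 is "\<lambda>_. 1" by (simp add: rel2_def)

lift_definition uminus_padic2 :: "padic2 \<Rightarrow> padic2" is "\<lambda>X n. - X n"
  using null2_diff null2_minus by (fastforce simp: rel2_def cauchy2_minus)

lift_definition plus_padic2 :: "padic2 \<Rightarrow> padic2 \<Rightarrow> padic2" is "\<lambda>X Y n. X n + Y n"
proof -
  fix X X' Y Y' assume "rel2 X X'" "rel2 Y Y'"
  then show "rel2 (\<lambda>n. X n + Y n) (\<lambda>n. X' n + Y' n)"
    using null2_add[of "\<lambda>n. X n - X' n" "\<lambda>n. Y n - Y' n"]
    by (simp add: rel2_def cauchy2_add algebra_simps)
qed

lift_definition minus_padic2 :: "padic2 \<Rightarrow> padic2 \<Rightarrow> padic2" is "\<lambda>X Y n. X n - Y n"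
proof -
  fix X X' Y Y' assume "rel2 X X'" "rel2 Y Y'"
  then show "rel2 (\<lambda>n. X n - Y n) (\<lambda>n. X' n - Y' n)"
    using null2_diff[of "\<lambda>n. X n - X' n" "\<lambda>n. Y n - Y' n"]
    by (simp add: rel2_def cauchy2_diff algebra_simps)
qed

lift_definition times_padic2 :: "padic2 \<Rightarrow> padic2 \<Rightarrow> padic2" is "\<lambda>X Y n. X n * Y n"
proof -
  fix X X' Y Y' assume "rel2 X X'" "rel2 Y Y'"
  then show "rel2 (\<lambda>n. X n * Y n) (\<lambda>n. X' n * Y' n)"
    using null2_add[OF null2_mult[of "\<lambda>n. X n - X' n" Y] null2_mult[of "\<lambda>n. Y n - Y' n" X']]
    by (simp add: rel2_def cauchy2_mult algebra_simps)
qed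

lift_definition inverse_padic2 :: "padic2 \<Rightarrow> padic2"
  is "\<lambda>X. if null2 X then (\<lambda>_. 0) else (\<lambda>n. inverse (X n))"
proof -
  fix X Y assume r: "rel2 X Y"
  then have eq: "null2 X = null2 Y" by (rule null2_rel)
  have "rel2 (\<lambda>n. inverse (X n)) (\<lambda>n. inverse (Y n))" if nX: "\<not> null2 X"
  proof -
    have nY: "\<not> null2 Y" using nX eq by simp
    have C: "cauchy2 X" "cauchy2 Y" "null2 (\<lambda>n. X n - Y n)" using r by (auto simp: rel2_def)
    have CI: "cauchy2 (\<lambda>n. inverse (X n))" "cauchy2 (\<lambda>n. inverse (Y n))"
      using C nX nY by (auto intro: cauchy2_inverse)
    obtain c M where c: "c > 0" "\<And>n. n \<ge> M \<Longrightarrow> abs2 (X n) = c"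
      using abs2_eventually_const[OF C(1) nX] by blast
    obtain d N where d: "d > 0" "\<And>n. n \<ge> N \<Longrightarrow> abs2 (Y n) = d"
      using abs2_eventually_const[OF C(2) nY] by blast
    have null: "null2 (\<lambda>n. (X n - Y n) * (inverse (X n) * inverse (Y n)))"
      by (intro null2_mult cauchy2_mult CI C)
    have "abs2 ((X n - Y n) * (inverse (X n) * inverse (Y n))) = abs2 (inverse (X n) - inverse (Y n))"
      if "n \<ge> max M N" for n
    proof -
      have "X n \<noteq> 0" "Y n \<noteq> 0" using c(2)[of n] d(2)[of n] c(1) d(1) that by auto
      then have "(X n - Y n) * (inverse (X n) * inverse (Y n)) = inverse (Y n) - inverse (X n)"
        by (simp add: field_simps)
      then show ?thesis by (simp add: abs2_minus_commute)
    qed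
    then have "null2 (\<lambda>n. inverse (X n) - inverse (Y n))"
      using null unfolding null2_def by (blast intro: Lim_transform_eventually eventually_sequentiallyI)
    then show ?thesis using CI by (simp add: rel2_def)
  qed
  then show "rel2 (if null2 X then \<lambda>_. 0 else (\<lambda>n. inverse (X n)))
                  (if null2 Y then \<lambda>_. 0 else (\<lambda>n. inverse (Y n)))"
    using eq by (auto simp: rel2_def)
qed

definition "x div y = x * inverse y" for x y :: padic2

instance
proof
  fix a b c :: padic2
  show "a + b + c = a + (b + c)" by transfer (simp add: rel2_def cauchy2_add algebra_simps)
  show "a + b = b + a" by transfer (simp add: rel2_def cauchy2_add algebra_simps)
  show "0 + a = a" by transfer (simp add: rel2_def)
  show "- a + a = 0" by transfer (simp add: rel2_def)
  show "a - b = a + - b" by transfer (simp add: rel2_def cauchy2_diff)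
  show "a * b * c = a * (b * c)" by transfer (simp add: rel2_def cauchy2_mult algebra_simps)
  show "a * b = b * a" by transfer (simp add: rel2_def cauchy2_mult algebra_simps)
  show "1 * a = a" by transfer (simp add: rel2_def)
  show "(a + b) * c = a * c + b * c"
    by transfer (simp add: rel2_def cauchy2_mult cauchy2_add algebra_simps)
  show "(0 :: padic2) \<noteq> 1" by transfer (simp add: rel2_def)
  show "a \<noteq> 0 \<Longrightarrow> inverse a * a = 1"
  proof transfer
    fix X assume X: "rel2 X X" "\<not> rel2 X (\<lambda>_. 0)"
    then have C: "cauchy2 X" and N: "\<not> null2 X" by (auto simp: rel2_def)
    obtain d M where d: "d > 0" "\<And>n. n \<ge> M \<Longrightarrow> abs2 (X n) = d"
      using abs2_eventually_const[OF C N] by blast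
    have "(\<lambda>n. abs2 (inverse (X n) * X n - 1)) \<longlonglongrightarrow> 0"
    proof (rule tendsto_eventually, rule eventually_sequentiallyI)
      fix n assume "M \<le> n"
      then have "X n \<noteq> 0" using d by force
      then show "abs2 (inverse (X n) * X n - 1) = 0" by simp
    qed
    then show "rel2 (\<lambda>n. (if null2 X then \<lambda>_. 0 else (\<lambda>n. inverse (X n))) n * X n) (\<lambda>_. 1)"
      using C N by (simp add: rel2_def null2_def[of "\<lambda>n. _ n - 1"] cauchy2_mult cauchy2_inverse)
  qed
  show "a div b = a * inverse b" by (simp add: divide_padic2_def)
  show "inverse (0 :: padic2) = 0" by transfer (simp add: rel2_def)
qed

end


lemma abs2_lim:
  assumes "cauchy2 X" shows "(\<lambda>n. abs2 (X n)) \<longlonglongrightarrow> lim (\<lambda>n. abs2 (X n))"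
proof -
  have "Cauchy (\<lambda>n. abs2 (X n))"
  proof (rule metric_CauchyI)
    fix e :: real assume "e > 0"
    then obtain M where M: "\<forall>m\<ge>M. \<forall>n\<ge>M. abs2 (X m - X n) < e"
      using assms unfolding cauchy2_def by blast
    then have "dist (abs2 (X m)) (abs2 (X n)) < e" if "m \<ge> M" "n \<ge> M" for m n
      using that abs2_diff_bound[of "X m" "X n"] by (fastforce simp: dist_real_def)
    then show "\<exists>M. \<forall>m\<ge>M. \<forall>n\<ge>M. dist (abs2 (X m)) (abs2 (X n)) < e" by blast
  qed
  then show ?thesis by (simp add: Cauchy_convergent_iff convergent_LIMSEQ_iff)
qed

lift_definition norm2 :: "padic2 \<Rightarrow> real" is "\<lambda>X. lim (\<lambda>n. abs2 (X n))"
proof -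
  fix X Y assume "rel2 X Y"
  then have X: "cauchy2 X" and N: "(\<lambda>n. abs2 (X n - Y n)) \<longlonglongrightarrow> 0"
    by (auto simp: rel2_def null2_def)
  have "(\<lambda>n. abs2 (Y n) - abs2 (X n)) \<longlonglongrightarrow> 0"
    by (rule tendsto_0_le[OF N, of _ 1])
      (use abs2_diff_bound in \<open>auto simp: abs_minus_commute\<close>)
  from tendsto_add[OF this abs2_lim[OF X]]
  show "lim (\<lambda>n. abs2 (X n)) = lim (\<lambda>n. abs2 (Y n))" by (auto intro: limI[symmetric])
qed

lemma norm2_eq_0_iff: "norm2 (x :: padic2) = 0 \<longleftrightarrow> x = 0"
proof transfer
  fix X assume "rel2 X X"
  then have X: "cauchy2 X" by (simp add: rel2_def)
  then have "lim (\<lambda>n. abs2 (X n)) = 0 \<longleftrightarrow> null2 X"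
    unfolding null2_def using abs2_lim limI by metis
  then show "lim (\<lambda>n. abs2 (X n)) = 0 \<longleftrightarrow> rel2 X (\<lambda>_. 0)" using X by (simp add: rel2_def)
qed

lemma norm2_nonneg: "norm2 (x :: padic2) \<ge> 0"
proof transfer
  fix X assume "rel2 X X"
  then have X: "cauchy2 X" by (simp add: rel2_def)
  show "lim (\<lambda>n. abs2 (X n)) \<ge> 0"
    by (rule LIMSEQ_le_const[OF abs2_lim[OF X]]) auto
qed

lemma norm2_add_le: "norm2 (x + y :: padic2) \<le> max (norm2 x) (norm2 y)"
proof transfer
  fix X Y assume "rel2 X X" "rel2 Y Y"
  then have C: "cauchy2 X" "cauchy2 Y" by (auto simp: rel2_def)
  show "lim (\<lambda>n. abs2 (X n + Y n)) \<le> max (lim (\<lambda>n. abs2 (X n))) (lim (\<lambda>n. abs2 (Y n)))"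
    by (rule LIMSEQ_le[OF abs2_lim[OF cauchy2_add[OF C]] tendsto_max[OF abs2_lim[OF C(1)] abs2_lim[OF C(2)]]])
      (simp add: abs2_add_le)
qed

lemma norm2_mult: "norm2 (x * y :: padic2) = norm2 x * norm2 y"
proof transfer
  fix X Y assume "rel2 X X" "rel2 Y Y"
  then have C: "cauchy2 X" "cauchy2 Y" by (auto simp: rel2_def)
  show "lim (\<lambda>n. abs2 (X n * Y n)) = lim (\<lambda>n. abs2 (X n)) * lim (\<lambda>n. abs2 (Y n))"
    unfolding abs2_mult by (intro limI tendsto_mult abs2_lim C)
qed

lemma norm2_minus: "norm2 (- x :: padic2) = norm2 x"
  by transfer simp

lemma norm2_minus_commute: "norm2 (x - y :: padic2) = norm2 (y - x)"
  using norm2_minus[of "x - y"] by simp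

instantiation padic2 :: metric_space
begin

definition dist_padic2 :: "padic2 \<Rightarrow> padic2 \<Rightarrow> real" where
  "dist_padic2 x y = norm2 (x - y)"

definition uniformity_padic2 :: "(padic2 \<times> padic2) filter" where
  "uniformity_padic2 = (INF e\<in>{0 <..}. principal {(x, y). dist x y < e})"

definition open_padic2 :: "padic2 set \<Rightarrow> bool" where
  "open_padic2 U \<longleftrightarrow> (\<forall>x\<in>U. eventually (\<lambda>(x', y). x' = x \<longrightarrow> y \<in> U) uniformity)"

instance
proof
  fix x y z :: padic2
  show "dist x y = 0 \<longleftrightarrow> x = y" by (simp add: dist_padic2_def norm2_eq_0_iff)
  show "dist x y \<le> dist x z + dist y z"
    using norm2_add_le[of "x - z" "z - y"] norm2_nonneg[of "x - z"]
      norm2_nonneg[of "z - y"] norm2_minus_commute[of y z]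
    by (simp add: dist_padic2_def)
qed (simp_all add: uniformity_padic2_def open_padic2_def)

end

lemma of_nat_padic2: "(of_nat n :: padic2) = abs_padic2 (\<lambda>_. of_nat n)"
  by (induction n)
    (simp_all add: zero_padic2_def one_padic2_def plus_padic2.abs_eq rel2_def)

instance padic2 :: field_char_0
proof
  show "inj (of_nat :: nat \<Rightarrow> padic2)"
  proof (rule injI)
    fix m n assume eq: "(of_nat m :: padic2) = of_nat n"
    define X Y :: "nat \<Rightarrow> rat" where "X = (\<lambda>_. of_nat m)" and "Y = (\<lambda>_. of_nat n)"
    have "rel2 X X" "rel2 Y Y" by (simp_all add: X_def Y_def rel2_def)
    moreover have "abs_padic2 X = abs_padic2 Y" using eq by (simp add: of_nat_padic2 X_def Y_def)
    ultimately have "rel2 X Y" using Quotient_rel[OF Quotient_padic2] by blast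
    then show "m = n" by (simp add: X_def Y_def rel2_def)
  qed
qed

lemma of_int_padic2: "(of_int k :: padic2) = abs_padic2 (\<lambda>_. of_int k)"
  by (cases k rule: int_cases2)
    (simp_all add: of_nat_padic2 uminus_padic2.abs_eq rel2_def)

lemma of_rat_padic2: "(of_rat q :: padic2) = abs_padic2 (\<lambda>_. q)"
proof -
  obtain a b :: int where q: "b \<noteq> 0" "q = of_int a / of_int b" by (rule rat_cases2)
  have "abs_padic2 (\<lambda>_. q) * of_int b = of_int a"
    using q by (simp add: of_int_padic2 times_padic2.abs_eq rel2_def)
  then have "abs_padic2 (\<lambda>_. q) = of_int a / of_int b"
    using q(1) by (simp add: nonzero_eq_divide_eq)
  then show ?thesis by (simp add: q(2) of_rat_divide)
qed

lemma norm2_of_rat: "norm2 (of_rat q :: padic2) = abs2 q"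
  by (simp add: of_rat_padic2 norm2.abs_eq rel2_def limI)

lemma of_rat_tendsto_padic2:
  assumes "cauchy2 X" shows "(\<lambda>n. of_rat (X n)) \<longlonglongrightarrow> abs_padic2 X"
proof (rule metric_LIMSEQ_I)
  fix e :: real assume e: "e > 0"
  then obtain M where M: "\<forall>m\<ge>M. \<forall>n\<ge>M. abs2 (X m - X n) < e / 2"
    using assms unfolding cauchy2_def by (meson half_gt_zero)
  have "dist (of_rat (X n)) (abs_padic2 X) < e" if "n \<ge> M" for n
  proof -
    have "dist (of_rat (X n)) (abs_padic2 X) = lim (\<lambda>k. abs2 (X n - X k))"
      using assms by (simp add: dist_padic2_def of_rat_padic2 minus_padic2.abs_eq rel2_def
          norm2.abs_eq cauchy2_diff)
    also have "\<dots> \<le> e / 2"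
      by (rule LIMSEQ_le_const2[OF abs2_lim[OF cauchy2_diff[OF cauchy2_const assms]]])
        (use M that in \<open>auto intro: less_imp_le\<close>)
    finally show ?thesis using e by simp
  qed
  then show "\<exists>no. \<forall>n\<ge>no. dist (of_rat (X n)) (abs_padic2 X) < e" by blast
qed

lemma of_rat_dense_padic2:
  assumes "e > 0" obtains q where "dist (of_rat q) (x :: padic2) < e"
proof -
  obtain X where X: "cauchy2 X" "x = abs_padic2 X"
    by (metis Quotient_padic2 Quotient_abs_rep Quotient_rep_reflp rel2_def)
  show ?thesis
    using metric_LIMSEQ_D[OF of_rat_tendsto_padic2[OF X(1)] assms] X(2) that by blast
qed

instance padic2 :: complete_space
proof
  fix x :: "nat \<Rightarrow> padic2" assume "Cauchy x"
  have "\<exists>q. dist (of_rat q) (x n) < inverse (real (Suc n))" for n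
    using of_rat_dense_padic2[of "inverse (real (Suc n))" "x n"] by auto
  then obtain q where q: "dist (of_rat (q n)) (x n) < inverse (real (Suc n))" for n by metis
  have null: "(\<lambda>n. dist (of_rat (q n)) (x n)) \<longlonglongrightarrow> 0"
    by (rule tendsto_sandwich[OF _ _ tendsto_const LIMSEQ_inverse_real_of_nat])
      (use less_imp_le[OF q] in auto)
  have "cauchy2 q"
    unfolding cauchy2_def
  proof (intro allI impI)
    fix e :: real assume e: "e > 0"
    obtain M where M: "\<forall>m\<ge>M. \<forall>n\<ge>M. dist (x m) (x n) < e / 3"
      using \<open>Cauchy x\<close> e unfolding Cauchy_def by (meson divide_pos_pos zero_less_numeral)
    obtain N where N: "\<forall>n\<ge>N. dist (of_rat (q n)) (x n) < e / 3"
      using metric_LIMSEQ_D[OF null, of "e / 3"] e by auto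
    have "abs2 (q m - q n) < e" if "m \<ge> max M N" "n \<ge> max M N" for m n
    proof -
      have "abs2 (q m - q n) = dist (of_rat (q m) :: padic2) (of_rat (q n))"
        by (simp add: dist_padic2_def norm2_of_rat flip: of_rat_diff)
      moreover have "dist (x m) (x n) < e / 3" "dist (of_rat (q m)) (x m) < e / 3"
        "dist (of_rat (q n)) (x n) < e / 3" using M N that by auto
      ultimately show ?thesis
        using dist_triangle[of "of_rat (q m)" "of_rat (q n)" "x m"]
          dist_triangle[of "x m" "of_rat (q n)" "x n"] 
        by (simp add: dist_commute)
    qed
    then show "\<exists>M. \<forall>m\<ge>M. \<forall>n\<ge>M. abs2 (q m - q n) < e" by blast
  qed
  then have lim: "(\<lambda>n. of_rat (q n)) \<longlonglongrightarrow> abs_padic2 q" by (rule of_rat_tendsto_padic2)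
  have "x \<longlonglongrightarrow> abs_padic2 q"
    unfolding tendsto_dist_iff[of x]
  proof (rule tendsto_sandwich[OF _ _ tendsto_const])
    show "(\<lambda>n. dist (of_rat (q n)) (x n) + dist (of_rat (q n)) (abs_padic2 q)) \<longlonglongrightarrow> 0"
      using tendsto_add[OF null iffD1[OF tendsto_dist_iff lim]] by simp
    show "\<forall>\<^sub>F n in sequentially. dist (x n) (abs_padic2 q)
            \<le> dist (of_rat (q n)) (x n) + dist (of_rat (q n)) (abs_padic2 q)"
      by (simp add: dist_triangle3)
  qed simp
  then show "convergent x" by (rule convergentI)
qed


text \<open>The 2-adic integers as the closed unit ball.  By \<open>binary_expansion_Z2\<close> they are exactly the
  elements with a (necessarily unique) expansion $\sum_i \varepsilon_i 2^i$, where
  $\varepsilon_i \in \{0,1\}$.\<close>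

definition Z2 :: "padic2 set" where
  "Z2 = {x. norm2 x \<le> 1}"

definition binary_expansion :: "(nat \<Rightarrow> nat) \<Rightarrow> padic2 \<Rightarrow> bool" where
  "binary_expansion \<epsilon> x \<longleftrightarrow> (\<forall>i. \<epsilon> i \<in> {0, 1}) \<and> (\<lambda>i. of_nat (\<epsilon> i) * 2 ^ i) sums x"

lemma abs2_of_int_odd: "odd b \<Longrightarrow> abs2 (of_int b) = 1"
  using val2_divide[of b 1] by (auto simp: abs2_def not_dvd_imp_multiplicity_0)

lemma abs2_of_int_le: "abs2 (of_int a) \<le> 1"
  using val2_divide[of a 1] by (cases "a = 0") (auto simp: abs2_def power_int_minus field_simps)

lemma abs2_two: "abs2 2 = 1 / 2"
  using val2_divide[of 2 1] by (simp add: abs2_def power_int_minus multiplicity_self field_simps)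

lemma abs2_residue:
  assumes "abs2 q \<le> 1" shows "abs2 q \<le> 1 / 2 \<or> abs2 (q - 1) \<le> 1 / 2"
proof -
  obtain a b where ab: "quotient_of q = (a, b)" by fastforce
  have q: "q = of_int a / of_int b" and b: "b > 0" and cop: "coprime a b"
    using quotient_of_div[OF ab] quotient_of_denom_pos[OF ab] quotient_of_coprime[OF ab] .
  have aq: "abs2 (of_int c / of_int b) = abs2 (of_int c) / abs2 (of_int b)" for c
    by (simp add: divide_inverse abs2_mult abs2_inverse)
  have even: "abs2 (of_int c) \<le> 1 / 2" if c: "even c" for c
  proof -
    obtain k where "c = 2 * k" using c by (rule evenE)
    then show ?thesis using abs2_of_int_le[of k] by (simp add: abs2_mult abs2_two)
  qed
  have "odd b"
  proof
    assume "even b"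
    then have "odd a" using cop by (metis coprime_common_divisor odd_one)
    then have "abs2 q = 1 / abs2 (of_int b)" unfolding q aq by (simp add: abs2_of_int_odd)
    then have "1 \<le> abs2 (of_int b)"
      using assms b abs2_nonneg[of "of_int b"] by (simp add: divide_le_eq_1 split: if_splits)
    then show False using even[OF \<open>even b\<close>] by simp
  qed
  then have *: "abs2 (of_int c / of_int b) \<le> 1 / 2" if "even c" for c
    unfolding aq using even[OF that] by (simp add: abs2_of_int_odd)
  show ?thesis
  proof (cases "even a")
    case False
    have "q - 1 = of_int (a - b) / of_int b" using b q by (simp add: field_simps)
    then show ?thesis using *[of "a - b"] False \<open>odd b\<close> by simp
  qed (use * q in simp)
qed

lemma norm2_two_power: "norm2 (2 ^ n) = (1 / 2) ^ n"
proof -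
  have "norm2 1 = 1" using norm2_of_rat[of 1] by simp
  moreover have "norm2 2 = 1 / 2" using norm2_of_rat[of 2] by (simp add: abs2_two)
  ultimately show ?thesis by (induction n) (simp_all add: norm2_mult)
qed

lemma Z2_step:
  assumes "x \<in> Z2"
  shows "\<exists>d y. d \<in> {0, 1 :: nat} \<and> y \<in> Z2 \<and> x = of_nat d + 2 * y"
proof -
  obtain q where q: "norm2 (of_rat q - x) < 1 / 2"
    using of_rat_dense_padic2[of "1 / 2" x] by (auto simp: dist_padic2_def)
  have "norm2 (of_rat q) \<le> 1"
    using norm2_add_le[of "of_rat q - x" x] q assms by (simp add: Z2_def)
  then have "abs2 q \<le> 1 / 2 \<or> abs2 (q - 1) \<le> 1 / 2"
    by (intro abs2_residue) (simp add: norm2_of_rat)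
  then obtain d :: nat where d: "d \<in> {0, 1}" "abs2 (q - of_nat d) \<le> 1 / 2"
    by (metis diff_zero insertCI of_nat_0 of_nat_1)
  have "norm2 (of_rat q - of_nat d) \<le> 1 / 2"
    using d(2) norm2_of_rat[of "q - of_nat d"] by (simp add: of_rat_diff)
  then have le: "norm2 (x - of_nat d) \<le> 1 / 2"
    using norm2_add_le[of "x - of_rat q" "of_rat q - of_nat d"] q norm2_minus_commute[of x "of_rat q"]
    by simp
  define y where "y = (x - of_nat d) / 2"
  have eq: "x = of_nat d + 2 * y" unfolding y_def by (simp del: distrib_left_numeral right_diff_distrib_numeral)
  then have "norm2 (2 * y) \<le> 1 / 2" using le by simp
  moreover have "norm2 2 = 1 / 2" using norm2_two_power[of 1] by simp
  ultimately have "y \<in> Z2" by (simp add: Z2_def norm2_mult)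
  then show ?thesis using d(1) eq by blast
qed

lemma binary_expansion_norm2_le:
  assumes "binary_expansion \<epsilon> x"
  shows "norm2 (x - (\<Sum>i<n. of_nat (\<epsilon> i) * 2 ^ i)) \<le> (1 / 2) ^ n"
proof -
  define P where "P m = (\<Sum>i<m. of_nat (\<epsilon> i) * (2 :: padic2) ^ i)" for m
  have z: "norm2 0 = 0" by (simp add: norm2_eq_0_iff)
  have *: "norm2 (P m - P n) \<le> (1 / 2) ^ n" if "n \<le> m" for m
    using that
  proof (induction m rule: dec_induct)
    case (step m)
    have "\<epsilon> m = 0 \<or> \<epsilon> m = 1" using assms by (auto simp: binary_expansion_def)
    then have "norm2 (of_nat (\<epsilon> m) * 2 ^ m) \<le> (1 / 2) ^ m"
      using z by (auto simp: norm2_two_power)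
    also have "\<dots> \<le> (1 / 2) ^ n" using step by (intro power_decreasing) auto
    finally show ?case
      using norm2_add_le[of "P m - P n" "of_nat (\<epsilon> m) * 2 ^ m"] step
      by (simp add: P_def algebra_simps)
  qed (simp add: z)
  have "P \<longlonglongrightarrow> x" using assms by (simp add: binary_expansion_def sums_def P_def[abs_def])
  then obtain k where "\<forall>m\<ge>k. dist (P m) x < (1 / 2) ^ n"
    using metric_LIMSEQ_D[of P x "(1 / 2) ^ n"] by auto
  then have "norm2 (x - P (max k n)) < (1 / 2) ^ n"
    by (simp add: dist_padic2_def norm2_minus_commute)
  then show ?thesis
    using norm2_add_le[of "x - P (max k n)" "P (max k n) - P n"] *[of "max k n"]
    by (simp add: P_def)
qed

lemma binary_expansion_unique:
  assumes "binary_expansion \<epsilon> x" "binary_expansion \<delta> x" shows "\<epsilon> = \<delta>"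
proof
  fix i show "\<epsilon> i = \<delta> i"
  proof (induction i rule: less_induct)
    case (less i)
    define s where "s = (\<Sum>j<i. of_nat (\<epsilon> j) * (2 :: padic2) ^ j)"
    have s': "s = (\<Sum>j<i. of_nat (\<delta> j) * 2 ^ j)" unfolding s_def using less by (intro sum.cong) auto
    have 1: "norm2 (x - (s + of_nat (\<epsilon> i) * 2 ^ i)) \<le> (1 / 2) ^ Suc i"
      using binary_expansion_norm2_le[OF assms(1), of "Suc i"] by (simp add: s_def)
    have 2: "norm2 (x - (s + of_nat (\<delta> i) * 2 ^ i)) \<le> (1 / 2) ^ Suc i"
      using binary_expansion_norm2_le[OF assms(2), of "Suc i"] by (simp add: s')
    have "norm2 ((of_nat (\<epsilon> i) - of_nat (\<delta> i)) * 2 ^ i) \<le> (1 / 2) ^ Suc i"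
      using norm2_add_le[of "x - (s + of_nat (\<delta> i) * 2 ^ i)" "- (x - (s + of_nat (\<epsilon> i) * 2 ^ i))"] 1 2
      unfolding norm2_minus by (simp add: algebra_simps)
    moreover have "(1 / 2 :: real) ^ Suc i < (1 / 2) ^ i" by simp
    ultimately have lt: "norm2 ((of_nat (\<epsilon> i) - of_nat (\<delta> i)) * 2 ^ i) < (1 / 2) ^ i" by linarith
    show ?case
    proof (rule ccontr)
      assume "\<epsilon> i \<noteq> \<delta> i"
      moreover have "\<epsilon> i \<in> {0, 1}" "\<delta> i \<in> {0, 1}" using assms by (simp_all add: binary_expansion_def)
      ultimately have "(of_nat (\<epsilon> i) - of_nat (\<delta> i) :: padic2) \<in> {1, - 1}" by auto
      then have "norm2 ((of_nat (\<epsilon> i) - of_nat (\<delta> i)) * 2 ^ i) = (1 / 2) ^ i"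
        by (auto simp: norm2_two_power norm2_minus)
      then show False using lt by simp
    qed
  qed
qed

lemma binary_expansion_exists:
  assumes "x \<in> Z2" shows "\<exists>\<epsilon>. binary_expansion \<epsilon> x"
proof -
  obtain d T where dT: "\<And>y. y \<in> Z2 \<Longrightarrow> d y \<in> {0, 1 :: nat} \<and> T y \<in> Z2 \<and> y = of_nat (d y) + 2 * T y"
    using Z2_step by metis
  define Y where "Y n = (T ^^ n) x" for n
  define P where "P n = (\<Sum>i<n. of_nat (d (Y i)) * (2 :: padic2) ^ i)" for n
  have Y: "Y n \<in> Z2" for n by (induction n) (use assms dT in \<open>auto simp: Y_def\<close>)
  have x: "x = P n + 2 ^ n * Y n" for n
  proof (induction n)
    case (Suc n)
    have "Y n = of_nat (d (Y n)) + 2 * Y (Suc n)" using dT[OF Y[of n]] by (simp add: Y_def)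
    then have "2 ^ n * Y n = of_nat (d (Y n)) * 2 ^ n + 2 ^ Suc n * Y (Suc n)"
      by (metis (no_types, lifting) distrib_left mult.assoc mult.commute power_Suc2)
    then show ?case using Suc by (simp add: P_def)
  qed (simp add: P_def Y_def)
  have "P \<longlonglongrightarrow> x"
    unfolding tendsto_dist_iff[of P]
  proof (rule tendsto_sandwich[OF _ _ tendsto_const])
    show "(\<lambda>n. (1 / 2 :: real) ^ n) \<longlonglongrightarrow> 0" by (intro LIMSEQ_power_zero) simp
    have "dist (P n) x \<le> (1 / 2) ^ n" for n
    proof -
      have "dist (P n) x = norm2 (2 ^ n * Y n)"
        using x[of n] norm2_minus_commute[of x "P n"] by (simp add: dist_padic2_def)
      also have "\<dots> \<le> (1 / 2) ^ n"
        using Y[of n] by (simp add: norm2_mult norm2_two_power Z2_def mult_left_le norm2_nonneg)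
      finally show ?thesis .
    qed
    then show "\<forall>\<^sub>F n in sequentially. dist (P n) x \<le> (1 / 2) ^ n" by simp
  qed simp
  then have "binary_expansion (\<lambda>i. d (Y i)) x"
    using dT[OF Y] by (simp add: binary_expansion_def sums_def P_def[abs_def])
  then show ?thesis by blast
qed

lemma binary_expansion_Z2: "(\<exists>!\<epsilon>. binary_expansion \<epsilon> x) \<longleftrightarrow> x \<in> Z2"
proof
  assume "\<exists>!\<epsilon>. binary_expansion \<epsilon> x"
  then show "x \<in> Z2" using binary_expansion_norm2_le[of _ x 0] by (auto simp: Z2_def)
qed (use binary_expansion_exists binary_expansion_unique in blast)

text \<open>Only meaningful for elements of \<open>Z2\<close>.\<close>

definition digit :: "padic2 \<Rightarrow> nat \<Rightarrow> nat" where
  "digit x = (THE \<epsilon>. binary_expansion \<epsilon> x)"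

text \<open>The truncation $x_n = \sum_{i=0}^n \varepsilon_i 2^i$, a natural number; the digit of index
  \<open>n\<close> is included.\<close>

definition trunc2 :: "padic2 \<Rightarrow> nat \<Rightarrow> nat" where
  "trunc2 x n = (\<Sum>i=0..n. digit x i * 2 ^ i)"

definition two_definable :: "(nat \<Rightarrow> rat) \<Rightarrow> padic2 \<Rightarrow> bool" where
  "two_definable f x \<longleftrightarrow> x \<in> Z2 \<and> convergent (\<lambda>n. of_rat (f (trunc2 x n)) :: padic2)"

text \<open>The value of the extension at \<open>x\<close>, only meaningful if \<open>two_definable f x\<close>.\<close>

definition bar :: "(nat \<Rightarrow> rat) \<Rightarrow> padic2 \<Rightarrow> padic2" where
  "bar f x = lim (\<lambda>n. of_rat (f (trunc2 x n)))"

end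

theory Submission
  imports Defs
begin

text \<open>With \<open>L n j = 1 / ((n + 1) * (n choose j))\<close>, the entries of Leibniz' harmonic triangle,
  the relation \<open>L (n + 1) j + L (n + 1) (j + 1) = L n j\<close> has two consequences. Every entry of row
  \<open>n\<close> has 2-adic absolute value at most \<open>n + 1\<close>, hence so has the row sum \<open>g n = f n / (n + 1)\<close>.
  Moreover \<open>g n = 2 * g (n + 1) - 2 / (n + 2)\<close>, so that
  \<open>f n = (n + 1) * (2 ^ T * g (n + T) - (\<Sum>j=1..T. 2 ^ j / (n + 1 + j)))\<close>.
  Let \<open>m\<close> and \<open>m + 2 ^ e\<close> be consecutive truncations of \<open>x\<close>, so \<open>m < e\<close>, and take \<open>T = 2 * e\<close>.
  All denominators \<open>m + 1 + j\<close> are below \<open>2 ^ e\<close>, so adding \<open>2 ^ e\<close> does not change their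
  absolute values, and the two expressions for \<open>f\<close> agree up to
  errors of size at most \<open>(e + j) ^ 2 / 2 ^ (e + j) \<le> 1 / e\<close> for large \<open>e\<close>.\<close>

section \<open>Further rules for the 2-adic absolute value, and bounds on integers\<close>

lemma abs2_divide: "abs2 (p / q) = abs2 p / abs2 q"
  by (simp add: divide_inverse abs2_mult abs2_inverse)

lemma abs2_power: "abs2 (q ^ n) = abs2 q ^ n"
  by (induction n) (simp_all add: abs2_mult)

lemma abs2_sum_le:
  assumes "\<And>i. i \<in> A \<Longrightarrow> abs2 (h i) \<le> B" "B \<ge> 0"
  shows "abs2 (sum h A) \<le> B"
  using assms
proof (induction A rule: infinite_finite_induct)
  case (insert a A)
  then show ?case using abs2_add_le[of "h a" "sum h A"] by fastforce
qed auto

lemma abs2_of_nat_le: "abs2 (of_nat a) \<le> 1"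
  using abs2_of_int_le[of "int a"] by simp

text \<open>The left side is the largest power of 2 dividing \<open>a\<close>, and a divisor of a
  positive integer is at most that integer.\<close>

lemma abs2_inverse_of_nat_le:
  assumes "a > 0" shows "inverse (abs2 (of_nat a)) \<le> real a"
proof -
  define v where "v = multiplicity 2 (int a)"
  have "2 ^ v dvd int a" unfolding v_def by (rule multiplicity_dvd)
  then have "2 ^ v \<le> int a" using assms by (intro zdvd_imp_le) auto
  then have "real_of_int (2 ^ v) \<le> real_of_int (int a)" by (simp only: of_int_le_iff)
  then have le: "(2::real) ^ v \<le> real a" by simp
  have "abs2 (of_nat a) = inverse (2 ^ v)"
    using assms val2_divide[of "int a" 1] by (simp add: abs2_def v_def power_int_minus)
  then show ?thesis using le by simp
qed

text \<open>As \<open>a < 2 ^ e\<close>, the power of 2 dividing \<open>a\<close> is below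
  \<open>2 ^ e\<close>; so \<open>2 ^ e\<close> is 2-adically smaller than \<open>a\<close> and the
  isosceles principle applies.\<close>

lemma abs2_add_two_power:
  assumes "0 < a" "a < 2 ^ e"
  shows "abs2 (of_nat (a + 2 ^ e)) = abs2 (of_nat a)"
proof (rule abs2_isosceles)
  have "abs2 (of_nat a) \<noteq> 0" using assms(1) by simp
  then have pos: "abs2 (of_nat a) > 0" using abs2_nonneg[of "of_nat a"] by linarith
  have "inverse (abs2 (of_nat a)) \<le> real a" using assms(1) by (rule abs2_inverse_of_nat_le)
  also have "real a < real (2 ^ e)" using assms(2) by (simp only: of_nat_less_iff)
  finally have "(1 / 2) ^ e < abs2 (of_nat a)"
    using pos by (simp add: field_simps)
  then show "abs2 (of_nat (a + 2 ^ e) - of_nat a) < abs2 (of_nat a)"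
    by (simp add: abs2_power abs2_two)
qed

section \<open>Leibniz' harmonic triangle and its row sums\<close>

definition leibniz :: "nat \<Rightarrow> nat \<Rightarrow> rat" where
  "leibniz n j = inverse (of_nat (Suc n) * of_nat (n choose j))"

text \<open>By absorption, \<open>b\<close> and \<open>c\<close> have the reciprocals
  \<open>(N + 1 - J) / ((N + 1) * a)\<close> and \<open>(J + 1) / ((N + 1) * a)\<close>. The
  numerators add up to \<open>N + 2\<close>, which cancels the prefactor of row
  \<open>Suc n\<close>. For \<open>j = Suc n\<close> the rule would fail, since
  \<open>inverse 0 = 0\<close>.\<close>

lemma leibniz_add:
  assumes "j \<le> n"
  shows "leibniz (Suc n) j + leibniz (Suc n) (Suc j) = leibniz n j"
proof -
  define a where "a = (of_nat (n choose j) :: rat)"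
  define b where "b = (of_nat (Suc n choose j) :: rat)"
  define c where "c = (of_nat (Suc n choose Suc j) :: rat)"
  define N where "N = (of_nat n :: rat)"
  define J where "J = (of_nat j :: rat)"
  have nz: "a \<noteq> 0" "b \<noteq> 0" "c \<noteq> 0" using assms by (simp_all add: a_def b_def c_def del: binomial_Suc_Suc)
  have N1: "N + 1 \<noteq> 0" "N + 2 \<noteq> 0" unfolding N_def
    by (metis of_nat_Suc of_nat_eq_0_iff add.commute nat.distinct(2))
       (metis of_nat_add of_nat_numeral of_nat_eq_0_iff add_is_0 zero_neq_numeral)
  have NJ: "of_nat (Suc n - j) = N + 1 - J" "of_nat (Suc n) = N + 1" "of_nat (Suc j) = J + 1"
    using assms by (simp_all add: of_nat_diff N_def J_def)
  have "(Suc n - j) * (Suc n choose j) = Suc n * (n choose j)"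
    using binomial_absorb_comp[of "Suc n" j] by simp
  then have "(of_nat ((Suc n - j) * (Suc n choose j)) :: rat) = of_nat (Suc n * (n choose j))"
    by (simp only:)
  then have b: "(N + 1 - J) * b = (N + 1) * a"
    unfolding of_nat_mult NJ a_def b_def .
  have "(of_nat (Suc n * (n choose j)) :: rat) = of_nat ((Suc n choose Suc j) * Suc j)"
    by (simp only: Suc_times_binomial_eq)
  then have c: "c * (J + 1) = (N + 1) * a"
    unfolding of_nat_mult NJ a_def c_def by (rule sym)
  have nn: "(N + 1) * a \<noteq> 0" using nz N1 by simp
  have ib: "inverse b = (N + 1 - J) / ((N + 1) * a)"
    using nz by (subst nonzero_eq_divide_eq[OF nn], subst b[symmetric]) simp
  have ic: "inverse c = (J + 1) / ((N + 1) * a)"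
    using nz by (subst nonzero_eq_divide_eq[OF nn], subst c[symmetric]) simp
  have "inverse (N + 2) * inverse b + inverse (N + 2) * inverse c
      = inverse (N + 2) * ((N + 2) / ((N + 1) * a))"
    unfolding ib ic by (simp add: add_divide_distrib diff_divide_distrib algebra_simps)
  also have "\<dots> = inverse ((N + 1) * a)" using N1 by (simp add: field_simps)
  finally show ?thesis
    by (simp add: leibniz_def a_def b_def c_def N_def add.commute del: binomial_Suc_Suc)
qed

text \<open>The border entry is \<open>1 / (n + 1)\<close>. Each further entry of row
  \<open>n\<close> is a difference of entries one column to the left, in rows \<open>n - 1\<close>
  and \<open>n\<close>, and the ultrametric inequality keeps the bound from growing.\<close>

lemma abs2_leibniz_le: "j \<le> n \<Longrightarrow> abs2 (leibniz n j) \<le> real (Suc n)"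
proof (induction j arbitrary: n)
  case 0
  then show ?case
    using abs2_inverse_of_nat_le[of "Suc n"] by (simp add: leibniz_def abs2_inverse)
next
  case (Suc j)
  then obtain k where k: "n = Suc k" "j \<le> k" by (cases n) auto
  have "leibniz n (Suc j) = leibniz k j + - leibniz n j"
    using leibniz_add[OF k(2)] k(1) by (simp add: algebra_simps)
  then have "abs2 (leibniz n (Suc j)) \<le> max (abs2 (leibniz k j)) (abs2 (leibniz n j))"
    using abs2_add_le[of "leibniz k j" "- leibniz n j"] by simp
  then show ?case using Suc.IH[OF k(2)] Suc.IH[of n] k by simp
qed

definition leibniz_sum :: "nat \<Rightarrow> rat" where
  "leibniz_sum n = (\<Sum>j=0..n. leibniz n j)"

lemma sum_inverse_binomial:
  "(\<Sum>j=0..n. inverse (of_nat (n choose j))) = of_nat (Suc n) * leibniz_sum n"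
  unfolding leibniz_sum_def leibniz_def sum_distrib_left
  by (intro sum.cong) (simp_all add: field_simps del: of_nat_Suc)

lemma abs2_leibniz_sum_le: "abs2 (leibniz_sum n) \<le> real (Suc n)"
  unfolding leibniz_sum_def by (rule abs2_sum_le) (auto intro: abs2_leibniz_le simp del: of_nat_Suc)

text \<open>Adding \<open>leibniz_add\<close> over row \<open>n\<close> counts every entry of row
  \<open>Suc n\<close> twice, except the two border entries \<open>1 / (n + 2)\<close>, which are
  counted once.\<close>

lemma leibniz_sum_Suc: "leibniz_sum n = 2 * leibniz_sum (Suc n) - 2 / of_nat (n + 2)"
proof -
  have "leibniz_sum n = (\<Sum>j=0..n. leibniz (Suc n) j) + (\<Sum>j=0..n. leibniz (Suc n) (Suc j))"
    unfolding leibniz_sum_def sum.distrib[symmetric] by (intro sum.cong) (auto simp: leibniz_add)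
  moreover have "leibniz_sum (Suc n) = (\<Sum>j=0..n. leibniz (Suc n) j) + leibniz (Suc n) (Suc n)"
    by (simp add: leibniz_sum_def)
  moreover have "leibniz_sum (Suc n) = leibniz (Suc n) 0 + (\<Sum>j=0..n. leibniz (Suc n) (Suc j))"
    unfolding leibniz_sum_def by (rule sum.atLeast0_atMost_Suc_shift[unfolded o_def])
  moreover have "leibniz (Suc n) 0 = 1 / of_nat (n + 2)" "leibniz (Suc n) (Suc n) = 1 / of_nat (n + 2)"
    by (simp_all add: leibniz_def inverse_eq_divide)
  ultimately show ?thesis by (simp add: algebra_simps)
qed

lemma leibniz_sum_shift:
  "leibniz_sum n = 2 ^ T * leibniz_sum (n + T) - (\<Sum>j=1..T. 2 ^ j / of_nat (n + 1 + j))"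
proof (induction T)
  case (Suc T)
  have "2 ^ T * leibniz_sum (n + T) = 2 ^ Suc T * leibniz_sum (n + Suc T) - 2 ^ Suc T / of_nat (n + 1 + Suc T)"
    by (subst leibniz_sum_Suc) (simp add: algebra_simps)
  then show ?case using Suc by simp
qed simp

section \<open>Comparison of \<open>f\<close> at \<open>m\<close> and at
  \<open>m + 2 ^ e\<close>\<close>

lemma cube_le_two_power: "n \<ge> 10 \<Longrightarrow> n ^ 3 \<le> (2::nat) ^ n"
proof (induction n rule: dec_induct)
  case (step n)
  \<comment> \<open>These give \<open>3 * n ^ 2 + 3 * n + 1 \<le> n ^ 3\<close>, so the cube at most
    doubles. The induction starts at 10 because 1000 \<le> 1024, whereas 729 > 512.\<close>
  have "10 * n \<le> n * n" "10 * (n * n) \<le> n * (n * n)" using step by auto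
  moreover have "n ^ 3 = n * (n * n)" "Suc n ^ 3 = n * (n * n) + 3 * (n * n) + 3 * n + 1"
    by (simp_all add: power3_eq_cube algebra_simps)
  ultimately have "Suc n ^ 3 \<le> 2 * n ^ 3" using step(1) by linarith
  then show ?case using step by simp
qed simp

lemma square_div_two_power_le:
  assumes "10 \<le> e" "e \<le> n"
  shows "(real n)\<^sup>2 / 2 ^ n \<le> 1 / real e"
proof -
  have "real (n ^ 3) \<le> real (2 ^ n)" using cube_le_two_power[of n] assms by (simp only: of_nat_le_iff)
  then have "(real n)\<^sup>2 * real n \<le> 2 ^ n" by (simp add: power2_eq_square power3_eq_cube)
  moreover have "(real n)\<^sup>2 * real e \<le> (real n)\<^sup>2 * real n" using assms by (intro mult_left_mono) auto
  ultimately have "(real n)\<^sup>2 * real e \<le> 2 ^ n" by linarith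
  then show ?thesis using assms by (simp add: field_simps)
qed

text \<open>The factor \<open>2 ^ (2 * e)\<close> has absolute value \<open>2 ^ (- 2 * e)\<close>,
  while the row sum has at most \<open>2 ^ (e + 1)\<close>; what is left is
  \<open>2 / 2 ^ e\<close>. The second hypothesis leaves room for both \<open>n = m\<close> and
  \<open>n = m + 2 ^ e\<close>.\<close>

lemma abs2_remainder_le:
  assumes "10 \<le> e" "n + 1 + 2 * e \<le> 2 ^ (e + 1)"
  shows "abs2 (of_nat (n + 1) * (2 ^ (2 * e) * leibniz_sum (n + 2 * e))) \<le> 1 / real e"
proof -
  have "abs2 (of_nat (n + 1)) * abs2 (leibniz_sum (n + 2 * e)) \<le> 1 * real (n + 1 + 2 * e)"
    using abs2_of_nat_le[of "n + 1"] abs2_leibniz_sum_le[of "n + 2 * e"]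
    by (intro mult_mono) auto
  also have "\<dots> \<le> 2 ^ (e + 1)"
    using assms(2) by (simp only: flip: of_nat_le_iff[where 'a = real]) simp
  finally have le: "abs2 (of_nat (n + 1)) * abs2 (leibniz_sum (n + 2 * e)) \<le> 2 ^ (e + 1)" .
  have "abs2 (of_nat (n + 1) * (2 ^ (2 * e) * leibniz_sum (n + 2 * e)))
      = (1 / 2) ^ (2 * e) * (abs2 (of_nat (n + 1)) * abs2 (leibniz_sum (n + 2 * e)))"
    by (simp only: abs2_mult abs2_power abs2_two ac_simps)
  also have "\<dots> \<le> (1 / 2) ^ (2 * e) * 2 ^ (e + 1)" using le by (rule mult_left_mono) simp
  also have "\<dots> = 2 / 2 ^ e" by (simp add: power_one_over mult_2[of e] power_add)
  also have "\<dots> \<le> (real e)\<^sup>2 / 2 ^ e"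
    using assms(1) power_mono[of 2 "real e" 2] by (intro divide_right_mono) auto
  also have "\<dots> \<le> 1 / real e" using square_div_two_power_le[of e e] assms(1) by simp
  finally show ?thesis .
qed

text \<open>Over a common denominator the numerator is \<open>2 ^ j * (j * (n - m))\<close> with
  \<open>n - m = 2 ^ e\<close>, so it is at most \<open>1 / 2 ^ (e + j)\<close> in absolute value.
  Each of the two denominators costs a factor of at most
  \<open>m + 1 + j \<le> e + j\<close>.\<close>

lemma abs2_term_diff_le:
  fixes m e j :: nat
  assumes "10 \<le> e" "m < e" "m + 1 + j < 2 ^ e"
  defines "n \<equiv> m + 2 ^ e"
  shows "abs2 (of_nat (n + 1) * (2 ^ j / of_nat (n + 1 + j)) - of_nat (m + 1) * (2 ^ j / of_nat (m + 1 + j)))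
    \<le> 1 / real e"
proof -
  define a where "a = m + 1 + j"
  have n: "n + 1 + j = a + 2 ^ e" by (simp add: n_def a_def)
  have A: "abs2 (of_nat (a + 2 ^ e)) = abs2 (of_nat a)"
    by (rule abs2_add_two_power) (use assms(3) in \<open>simp_all add: a_def\<close>)
  have diff: "u * (w / c) - v * (w / d) = w * ((u * d - v * c) / (c * d))"
    if "c \<noteq> 0" "d \<noteq> 0" for u v w c d :: rat
    using that by (simp add: field_simps)
  have nz: "(of_nat (a + 2 ^ e) :: rat) \<noteq> 0" "(of_nat a :: rat) \<noteq> 0"
    by (simp_all only: of_nat_eq_0_iff) (simp_all add: a_def)
  have "of_nat (n + 1) * (2 ^ j / of_nat (a + 2 ^ e)) - of_nat (m + 1) * (2 ^ j / of_nat a)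
      = 2 ^ j * ((of_nat (n + 1) * of_nat a - of_nat (m + 1) * of_nat (a + 2 ^ e))
          / (of_nat (a + 2 ^ e) * of_nat a :: rat))"
    by (rule diff) (fact nz)+
  also have "of_nat (n + 1) * of_nat a - of_nat (m + 1) * of_nat (a + 2 ^ e) = (of_nat j * 2 ^ e :: rat)"
    by (simp add: n_def a_def algebra_simps)
  finally have eq: "of_nat (n + 1) * (2 ^ j / of_nat (a + 2 ^ e)) - of_nat (m + 1) * (2 ^ j / of_nat a)
      = 2 ^ j * (of_nat j * 2 ^ e / (of_nat (a + 2 ^ e) * of_nat a :: rat))" .
  have "abs2 (of_nat (n + 1) * (2 ^ j / of_nat (a + 2 ^ e)) - of_nat (m + 1) * (2 ^ j / of_nat a))
      = (1 / 2) ^ (e + j) * abs2 (of_nat j) * (inverse (abs2 (of_nat a)))\<^sup>2"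
    unfolding eq abs2_mult abs2_divide A abs2_power abs2_two
    by (simp only: power_add power2_eq_square divide_inverse inverse_mult_distrib ac_simps)
  also have "\<dots> \<le> (1 / 2) ^ (e + j) * 1 * (real (e + j))\<^sup>2"
  proof (intro mult_mono power_mono)
    show "inverse (abs2 (of_nat a)) \<le> real (e + j)"
      using abs2_inverse_of_nat_le[of a] assms(2) by (simp add: a_def)
  qed (simp_all add: abs2_of_nat_le)
  also have "\<dots> = (real (e + j))\<^sup>2 / 2 ^ (e + j)" by (simp add: power_divide)
  also have "\<dots> \<le> 1 / real e" using assms(1) by (intro square_div_two_power_le) auto
  finally show ?thesis unfolding n a_def[symmetric] .
qed

lemma abs2_sum_inverse_binomial_diff_le:
  fixes f :: "nat \<Rightarrow> rat"
  defines "f \<equiv> (\<lambda>n. \<Sum>j=0..n. inverse (of_nat (n choose j)))"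
  assumes "10 \<le> e" "m < e"
  shows "abs2 (f (m + 2 ^ e) - f m) \<le> 1 / real e"
proof -
  define n where "n = m + 2 ^ e"
  define R where "R n = of_nat (n + 1) * (2 ^ (2 * e) * leibniz_sum (n + 2 * e))" for n
  define t where "t n j = of_nat (n + 1) * (2 ^ j / of_nat (n + 1 + j) :: rat)" for n j
  have f: "f k = R k - (\<Sum>j=1..2 * e. t k j)" for k
    unfolding f_def sum_inverse_binomial R_def t_def
    by (subst leibniz_sum_shift[of k "2 * e"]) (simp add: right_diff_distrib sum_distrib_left del: of_nat_add of_nat_Suc)
  \<comment> \<open>The chain behind \<open>small\<close> is
    \<open>m + 1 + 2 * e \<le> 3 * e < 4 * e \<le> e ^ 3 \<le> 2 ^ e\<close>.\<close>
  have "4 * e \<le> e * e" "e * e \<le> e ^ 3"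
    using assms(2) power_increasing[of 2 3 e] by (simp_all add: power2_eq_square)
  then have small: "m + 1 + 2 * e < 2 ^ e" using cube_le_two_power[of e] assms(2,3) by linarith
  have "abs2 (R n - R m) \<le> 1 / real e"
    using abs2_add_le[of "R n" "- R m"] abs2_remainder_le[of e n] abs2_remainder_le[of e m] assms(2) small
    by (simp add: R_def n_def)
  moreover have "abs2 (\<Sum>j=1..2 * e. t n j - t m j) \<le> 1 / real e"
  proof (rule abs2_sum_le)
    fix j assume "j \<in> {1..2 * e}"
    then show "abs2 (t n j - t m j) \<le> 1 / real e"
      unfolding t_def n_def using assms(2,3) small by (intro abs2_term_diff_le) auto
  qed simp
  moreover have "f n - f m = (R n - R m) + - (\<Sum>j=1..2 * e. t n j - t m j)"
    by (simp add: f sum_subtractf)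
  ultimately show ?thesis
    using abs2_add_le[of "R n - R m" "- (\<Sum>j=1..2 * e. t n j - t m j)"] by (simp add: n_def)
qed

section \<open>Cauchy sequences under the ultrametric inequality\<close>

lemma abs2_telescope_le:
  assumes "k \<le> l" "\<And>i. k \<le> i \<Longrightarrow> abs2 (X (Suc i) - X i) \<le> B" "B \<ge> 0"
  shows "abs2 (X l - X k) \<le> B"
  using assms(1)
proof (induction l rule: dec_induct)
  case (step l)
  then show ?case
    using assms(2)[of l] abs2_add_le[of "X (Suc l) - X l" "X l - X k"] by simp
qed (simp add: assms(3))

text \<open>Small consecutive differences suffice here: in an ultrametric, the error of a
  telescoping sum is the largest single error.\<close>

lemma cauchy2_if_diff_tendsto_0:
  assumes "\<And>e. e > 0 \<Longrightarrow> \<exists>K. \<forall>k\<ge>K. abs2 (X (Suc k) - X k) \<le> e"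
  shows "cauchy2 X"
  unfolding cauchy2_def
proof (intro allI impI)
  fix e :: real assume e: "e > 0"
  then obtain K where step: "\<forall>k\<ge>K. abs2 (X (Suc k) - X k) \<le> e / 2" using assms[of "e / 2"] by auto
  have K: "abs2 (X l - X K) \<le> e / 2" if "l \<ge> K" for l
    using step e by (intro abs2_telescope_le[OF that]) auto
  have "abs2 (X m - X n) < e" if "m \<ge> K" "n \<ge> K" for m n
    using abs2_add_le[of "X m - X K" "X K - X n"] K[OF that(1)] K[OF that(2)]
      abs2_minus_commute[of "X K" "X n"] e by simp
  then show "\<exists>M. \<forall>m\<ge>M. \<forall>n\<ge>M. abs2 (X m - X n) < e" by blast
qed

text \<open>Stated for index maps that tend to infinity, since the map applied later is constant
  between consecutive exponents.\<close>

lemma cauchy2_reindex: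
  assumes "cauchy2 X" "filterlim c at_top sequentially"
  shows "cauchy2 (\<lambda>n. X (c n))"
  unfolding cauchy2_def
proof (intro allI impI)
  fix e :: real assume "e > 0"
  then obtain M where M: "\<forall>m\<ge>M. \<forall>n\<ge>M. abs2 (X m - X n) < e"
    using assms(1) unfolding cauchy2_def by blast
  obtain L where "\<forall>n\<ge>L. c n \<ge> M"
    using assms(2) unfolding filterlim_at_top eventually_sequentially by blast
  then show "\<exists>L. \<forall>m\<ge>L. \<forall>n\<ge>L. abs2 (X (c m) - X (c n)) < e" using M by blast
qed

section \<open>Digits and truncations of a sum of distinct powers of 2\<close>

lemma binary_expansion_of_powers:
  assumes "strict_mono e" "(\<lambda>i. 2 ^ e i) sums x"
  shows "binary_expansion (\<lambda>i. if i \<in> range e then 1 else 0) x"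
proof -
  define d where "d i = (if i \<in> range e then 1 else 0 :: nat)" for i
  have "(\<lambda>i. of_nat (d (e i)) * 2 ^ e i) sums x" using assms(2) by (simp add: d_def)
  then have "(\<lambda>i. of_nat (d i) * 2 ^ i) sums x"
    using sums_mono_reindex[OF assms(1), of "\<lambda>i. of_nat (d i) * 2 ^ i" x] by (simp add: d_def)
  then show ?thesis by (simp add: binary_expansion_def d_def)
qed

text \<open>The least \<open>k\<close> with \<open>n < e k\<close> is the number of exponents up to
  \<open>n\<close>, and the nonzero digits of index at most \<open>n\<close> sit exactly at those
  exponents.\<close>

lemma trunc2_of_powers:
  assumes "strict_mono e" "(\<lambda>i. 2 ^ e i) sums x"
  shows "trunc2 x n = (\<Sum>i<(LEAST k. n < e k). 2 ^ e i)"
proof -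
  define k where "k = (LEAST k. n < e k)"
  have "n < e (Suc n)" using strict_mono_imp_increasing[OF assms(1), of "Suc n"] by simp
  then have k: "n < e k" unfolding k_def by (rule LeastI)
  have less: "e i \<le> n \<longleftrightarrow> i < k" for i
    using not_less_Least[of i "\<lambda>k. n < e k"] k strict_mono_less_eq[OF assms(1), of k i]
    by (fastforce simp: k_def not_less)
  have digit: "digit x = (\<lambda>i. if i \<in> range e then 1 else 0)"
    unfolding digit_def
    using binary_expansion_of_powers[OF assms] binary_expansion_unique by (intro the_equality) auto
  have "trunc2 x n = (\<Sum>i\<in>{0..n}. if i \<in> range e then 2 ^ i else 0)"
    unfolding trunc2_def digit by (intro sum.cong) auto
  also have "\<dots> = (\<Sum>i\<in>{0..n} \<inter> range e. 2 ^ i)" by (simp only: sum.inter_restrict finite_atLeastAtMost)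
  also have "{0..n} \<inter> range e = e ` {..<k}" by (auto simp: less)
  also have "(\<Sum>i\<in>e ` {..<k}. 2 ^ i) = (\<Sum>i<k. (2::nat) ^ e i)"
    by (simp add: sum.reindex strict_mono_imp_inj_on[OF assms(1)])
  finally show ?thesis by (simp add: k_def)
qed

lemma filterlim_Least_greater:
  assumes "strict_mono (e :: nat \<Rightarrow> nat)"
  shows "filterlim (\<lambda>n. LEAST k. n < e k) at_top sequentially"
  unfolding filterlim_at_top eventually_sequentially
proof (intro allI exI impI)
  \<comment> \<open>The threshold for \<open>K\<close> is \<open>e K\<close>: from there on, the
    first exponent above \<open>n\<close> has index greater than \<open>K\<close>.\<close>
  fix K n assume "e K \<le> n"
  moreover have "n < e (Suc n)" using strict_mono_imp_increasing[OF assms, of "Suc n"] by simp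
  then have "n < e (LEAST k. n < e k)" by (rule LeastI)
  ultimately show "K \<le> (LEAST k. n < e k)"
    using strict_mono_less_eq[OF assms, of "LEAST k. n < e k" K] by linarith
qed

theorem theorem1p9:
  fixes e :: "nat \<Rightarrow> nat" and x :: padic2 and N :: nat and f :: "nat \<Rightarrow> rat"
  defines "f \<equiv> (\<lambda>n. \<Sum>j=0..n. inverse (of_nat (n choose j)))"
  assumes "strict_mono e"
    and "(\<lambda>i. 2 ^ e i) sums x"
    and "N > 0"
    and "\<forall>k\<ge>N. e k > k + (\<Sum>i<k. 2 ^ e i)"
  shows "two_definable f x"
proof -
  define s where "s k = (\<Sum>i<k. 2 ^ e i :: nat)" for k
  have "cauchy2 (\<lambda>k. f (s k))"
  proof (rule cauchy2_if_diff_tendsto_0)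
    fix \<epsilon> :: real assume \<epsilon>: "\<epsilon> > 0"
    obtain M where M: "1 / \<epsilon> < real M" using reals_Archimedean2 by blast
    \<comment> \<open>\<open>N\<close> makes the gap hypothesis available; as
      \<open>e k > k\<close>, the bound 10 gives \<open>e k \<ge> 10\<close>, and \<open>M\<close>
      gives \<open>1 / e k < \<epsilon>\<close>.\<close>
    have "abs2 (f (s (Suc k)) - f (s k)) \<le> \<epsilon>" if "k \<ge> max N (max 10 M)" for k
    proof -
      have e: "k + s k < e k" using assms(5) that by (simp add: s_def)
      have "abs2 (f (s (Suc k)) - f (s k)) \<le> 1 / real (e k)"
        using abs2_sum_inverse_binomial_diff_le[of "e k" "s k"] e that by (simp add: f_def s_def)
      also have "1 / \<epsilon> < real (e k)" using M e that by linarith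
      then have "1 / real (e k) \<le> \<epsilon>" using \<epsilon> e by (simp add: field_simps)
      finally show ?thesis .
    qed
    then show "\<exists>K. \<forall>k\<ge>K. abs2 (f (s (Suc k)) - f (s k)) \<le> \<epsilon>" by blast
  qed
  \<comment> \<open>The truncations run through the partial sums \<open>s k\<close>, with
    repetitions.\<close>
  then have "cauchy2 (\<lambda>n. f (trunc2 x n))"
    using cauchy2_reindex[OF _ filterlim_Least_greater[OF assms(2)], of "\<lambda>k. f (s k)"]
    by (simp add: trunc2_of_powers[OF assms(2,3)] s_def)
  then have "convergent (\<lambda>n. of_rat (f (trunc2 x n)) :: padic2)"
    by (intro convergentI[OF of_rat_tendsto_padic2])
  moreover have "x \<in> Z2"
    using binary_expansion_Z2 binary_expansion_of_powers[OF assms(2,3)] binary_expansion_unique by blast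
  ultimately show ?thesis by (simp add: two_definable_def)
qed

end
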